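(* Let $q=p^{e}$ with $p$ an odd prime and $e\ge 1$, and let $l$ be an integer with $0\leq l\leq e-1$ and $2l\mid e$. Let $n$ be a positive integer with $n\leq p^{l}$. Then for any integers $k,h$ with $1\leq k\leq \lfloor\frac{n}{2}\rfloor$ and $0\leq h\leq k$, there exists an $[n,k]_{q}$ MDS code $\mathcal{C}$ with $h$-dimensional $l$-Galois hull, i.e. $\dim_{\mathbb{F}_q}(Hull_{l}(\mathcal{C}))=h$.
   Context: An $[n,k]_q$ code is a $k$-dimensional linear subspace $\mathcal{C}$ of $\mathbb{F}_q^n$; it is MDS if its minimum Hamming distance equals $n-k+1$. For $\mathbf{x},\mathbf{y}\in\mathbb{F}_q^n$ with $q=p^e$, the $l$-Galois form is $(\mathbf{x},\mathbf{y})_l=\sum_{i=1}^n x_i y_i^{p^l}$. The $l$-Galois dual of $\mathcal{C}$ is $\mathcal{C}^{\perp_l}=\{\mathbf{x}\in\mathbb{F}_q^n : (\mathbf{y},\mathbf{x})_l=0 \text{ for all } \mathbf{y}\in\mathcal{C}\}$, and the $l$-Galois hull is $Hull_l(\mathcal{C})=\mathcal{C}\cap\mathcal{C}^{\perp_l}$. *)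

theory Defs
  imports "HOL-Analysis.Cartesian_Space" "HOL-Computational_Algebra.Primes"
begin

definition linear_code :: "nat \<Rightarrow> nat \<Rightarrow> ('a::{field,finite} ^ 'n) set \<Rightarrow> bool" where
  "linear_code n k C \<longleftrightarrow> n = CARD('n) \<and> vec.subspace C \<and> vec.dim C = k"

definition hamming_distance :: "'a ^ 'n \<Rightarrow> 'a ^ 'n \<Rightarrow> nat" where
  "hamming_distance x y = card {i. x $ i \<noteq> y $ i}"

(* The infimum is attained as soon as C has two elements; otherwise the value is 0. *)
definition min_distance :: "('a ^ 'n) set \<Rightarrow> nat" where
  "min_distance C = Inf {hamming_distance x y | x y. x \<in> C \<and> y \<in> C \<and> x \<noteq> y}"

(* The subtraction never truncates, since a subspace satisfies k \<le> n. *)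
definition mds_code :: "nat \<Rightarrow> nat \<Rightarrow> ('a::{field,finite} ^ 'n) set \<Rightarrow> bool" where
  "mds_code n k C \<longleftrightarrow> linear_code n k C \<and> min_distance C = n - k + 1"

(* In the three definitions below, p is meant to be the characteristic of the field. *)
definition galois_form :: "nat \<Rightarrow> nat \<Rightarrow> 'a::field ^ 'n \<Rightarrow> 'a ^ 'n \<Rightarrow> 'a" where
  "galois_form p l x y = (\<Sum>i\<in>UNIV. x $ i * (y $ i) ^ (p ^ l))"

definition galois_dual :: "nat \<Rightarrow> nat \<Rightarrow> ('a::field ^ 'n) set \<Rightarrow> ('a ^ 'n) set" where
  "galois_dual p l C = {x. \<forall>y\<in>C. galois_form p l y x = 0}"

definition galois_hull :: "nat \<Rightarrow> nat \<Rightarrow> ('a::field ^ 'n) set \<Rightarrow> ('a ^ 'n) set" where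
  "galois_hull p l C = C \<inter> galois_dual p l C"

end

theory Submission
  imports Defs "HOL-Computational_Algebra.Polynomial"
begin

text \<open>Put \<open>r = p ^ l\<close>. As \<open>2 * l\<close> divides \<open>e\<close>, the field contains \<open>F\<^sub>r\<close> and its quadratic
  extension, so there are \<open>n\<close> distinct nodes \<open>a i \<in> F\<^sub>r\<close>, and every nonzero element of \<open>F\<^sub>r\<close> is an
  \<open>(r + 1)\<close>-th power. On the code \<open>{(v i * f (a i))\<^sub>i | deg f < k}\<close> the Galois form becomes
  \<open>\<Sum>i. v i ^ (r + 1) * g (a i) * f (a i) ^ r\<close>, where \<open>f (a i) ^ r\<close> is again the value at \<open>a i\<close> of a
  polynomial of degree below \<open>k\<close>. The numbers \<open>v i ^ (r + 1)\<close> are taken to be the Lagrange weights of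
  the nodes, with the sign changed at \<open>k - h\<close> of them; the hull then consists of the codewords that
  vanish at these \<open>k - h\<close> places.\<close>

section \<open>Finite fields: characteristic and power equations\<close>

text \<open>Translation by 1 permutes the ring, so it does not change the sum of all
  elements.\<close>

lemma of_nat_CARD_eq_0: "of_nat CARD('a) = (0 :: 'a::{ring_1,finite})"
proof -
  have "(\<Sum>x\<in>UNIV. x + 1) = (\<Sum>x\<in>UNIV. x :: 'a)"
    by (rule sum.reindex_bij_witness[of _ "\<lambda>x. x - 1" "\<lambda>x. x + 1"]) auto
  then show ?thesis
    by (simp add: sum.distrib)
qed

lemma CHAR_eq_prime:
  assumes "prime p" and "CARD('a::{field,finite}) = p ^ e"
  shows "CHAR('a) = p"
proof -
  have "prime CHAR('a)"
    using prime_CHAR_semidom[where ?'a = 'a] finite_imp_CHAR_pos[where ?'a = 'a] by simp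
  moreover have "CHAR('a) dvd p ^ e"
    using of_nat_CARD_eq_0[where ?'a = 'a] assms(2) by (simp add: of_nat_eq_0_iff_char_dvd[symmetric])
  ultimately show ?thesis
    using assms(1) by (metis prime_dvd_power primes_dvd_imp_eq)
qed

text \<open>Multiplication by \<open>x\<close> permutes the nonzero elements, so it does not change
  their product.\<close>

lemma power_CARD_minus_1:
  fixes x :: "'a::{field,finite}"
  assumes "x \<noteq> 0"
  shows "x ^ (CARD('a) - 1) = 1"
proof -
  have "(\<Prod>y\<in>UNIV-{0}. x * y) = (\<Prod>y\<in>UNIV-{0}. y)"
    by (rule prod.reindex_bij_witness[of _ "\<lambda>y. y / x" "\<lambda>y. x * y"]) (use assms in auto)
  then show ?thesis
    by (simp add: prod.distrib)
qed

text \<open>\<open>X ^ m - c\<close> divides \<open>X ^ (q - 1) - 1\<close>, which splits into distinct linear factors.\<close>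
lemma card_power_roots_ge:
  fixes c :: "'a::{field,finite}"
  assumes "CARD('a) - 1 = m * d" and "c ^ d = 1"
  shows "m \<le> card {x. x ^ m = c}"
proof -
  define N where "N = CARD('a) - 1"
  have "card {0, 1 :: 'a} \<le> CARD('a)"
    by (intro card_mono) auto
  then have "N > 0"
    by (simp add: N_def)
  then have "m > 0" "d > 0"
    using assms(1) by (auto simp: N_def intro: Nat.gr0I)
  define P where "P = monom 1 m - [:c:]"
  define A where "A = monom 1 N - (1 :: 'a poly)"
  have degree_diff: "degree (monom 1 j - [:b:]) = j" if "j > 0" for j and b :: 'a
    using that by (intro antisym degree_le le_degree) (auto simp: coeff_pCons split: nat.splits)
  have "P dvd monom 1 m ^ d - [:c:] ^ d"
    unfolding P_def power_diff_sumr2 by simp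
  also have "monom 1 m ^ d - [:c:] ^ d = A"
    using assms by (simp add: A_def N_def monom_power poly_const_pow one_pCons)
  finally obtain B where B: "A = P * B" ..
  have degA: "degree A = N" and degP: "degree P = m"
    using degree_diff[of N 1] degree_diff[of m c] \<open>N > 0\<close> \<open>m > 0\<close>
    by (simp_all add: A_def P_def one_pCons)
  have "A \<noteq> 0"
    using degA \<open>N > 0\<close> by auto
  then have "P \<noteq> 0" "B \<noteq> 0"
    using B by auto
  then have degB: "degree A = m + degree B"
    using B degP degree_mult_eq by metis
  have "poly A x = 0" if "x \<noteq> 0" for x
    using power_CARD_minus_1[OF that] by (simp add: A_def N_def poly_monom)
  \<comment> \<open>Each of the \<open>N\<close> nonzero elements is a root of \<open>P\<close> or
    of \<open>B\<close>. As \<open>B\<close> has at most \<open>N - m\<close> roots, at least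
    \<open>m\<close> are left for \<open>P\<close>.\<close>
  then have "UNIV - {0} \<subseteq> {x. poly P x = 0} \<union> {x. poly B x = 0}"
    using B by auto
  then have "card (UNIV - {0 :: 'a}) \<le> card ({x. poly P x = 0} \<union> {x. poly B x = 0})"
    by (intro card_mono) auto
  also have "\<dots> \<le> card {x. poly P x = 0} + degree B"
    using card_Un_le card_poly_roots_bound[OF \<open>B \<noteq> 0\<close>] by (meson add_left_mono order_trans)
  finally have "N \<le> card {x. poly P x = 0} + degree B"
    by (simp add: N_def)
  moreover have "{x. poly P x = 0} = {x. x ^ m = c}"
    by (auto simp: P_def poly_monom)
  ultimately show ?thesis
    using degA degB by simp
qed

text \<open>For \<open>q = r ^ (2 * s)\<close> this exhibits both \<open>r - 1\<close> and
  \<open>r + 1\<close> as divisors of \<open>q - 1\<close>: the first yields the nodes, the second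
  the preimages under the \<open>(r + 1)\<close>-th power.\<close>

lemma finite_field_power_exponent:
  fixes r s :: nat
  assumes "r > 1"
  obtains T where "(r ^ 2) ^ s - 1 = (r + 1) * ((r - 1) * T)"
proof -
  have "int r ^ 2 - 1 dvd (int r ^ 2) ^ s - 1"
    by (simp add: power_diff_1_eq)
  then have "r ^ 2 - 1 dvd (r ^ 2) ^ s - 1"
    using assms by (simp add: int_dvd_int_iff[symmetric] of_nat_diff)
  then obtain T where "(r ^ 2) ^ s - 1 = (r ^ 2 - 1) * T" ..
  moreover have "r ^ 2 - 1 = (r + 1) * (r - 1)"
    using assms by (simp add: power2_eq_square algebra_simps)
  ultimately show ?thesis
    using that by (simp only: mult.assoc)
qed

lemma card_subfield_ge:
  assumes "r > 1" and "CARD('a::{field,finite}) = (r ^ 2) ^ s"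
  shows "r \<le> card {x :: 'a. x ^ r = x}"
proof -
  obtain T where T: "CARD('a) - 1 = (r - 1) * ((r + 1) * T)"
    using finite_field_power_exponent[OF assms(1), of s] assms(2) by (metis mult.left_commute)
  \<comment> \<open>The nonzero solutions of \<open>x ^ r = x\<close> are the
    \<open>(r - 1)\<close>-th roots of unity; zero is the one further solution.\<close>
  have "r - 1 \<le> card {x :: 'a. x ^ (r - 1) = 1}"
    by (rule card_power_roots_ge[OF T]) simp
  then have "r \<le> card (insert 0 {x :: 'a. x ^ (r - 1) = 1})"
    using assms(1) by (subst card_insert_disjoint) (auto simp: power_0_left)
  also have "\<dots> \<le> card {x :: 'a. x ^ r = x}"
  proof (intro card_mono)
    have "x ^ r = x ^ (r - 1) * x" for x :: 'a
      using assms(1) power_minus_mult[of r x] by simp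
    then show "insert 0 {x :: 'a. x ^ (r - 1) = 1} \<subseteq> {x. x ^ r = x}"
      by auto
  qed simp
  finally show ?thesis .
qed

lemma norm_surjective:
  fixes c :: "'a::{field,finite}"
  assumes "r > 1" and "CARD('a) = (r ^ 2) ^ s" and "c ^ r = c" and "c \<noteq> 0"
  obtains v where "v ^ (r + 1) = c"
proof -
  obtain T where T: "CARD('a) - 1 = (r + 1) * ((r - 1) * T)"
    using finite_field_power_exponent[OF assms(1), of s] assms(2) by metis
  \<comment> \<open>The cofactor of \<open>r + 1\<close> in \<open>q - 1\<close> is a multiple of
    \<open>r - 1\<close>, so \<open>c\<close> raised to that cofactor is 1 as well.\<close>
  have "c ^ (r - 1) = 1"
    using assms by (simp add: power_eq_if)
  then have "r + 1 \<le> card {x. x ^ (r + 1) = c}"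
    by (intro card_power_roots_ge[OF T]) (simp add: power_mult)
  then have "{x. x ^ (r + 1) = c} \<noteq> {}"
    by (metis Suc_eq_plus1 card.empty not_less_eq_eq le0)
  then show ?thesis
    using that by blast
qed

text \<open>The \<open>r\<close>-th power is additive and multiplicative, and it fixes
  \<open>x\<close>, so it acts on the coefficients alone.\<close>

lemma poly_frobenius:
  fixes f :: "'a::field poly"
  assumes "prime CHAR('a)" and "r = CHAR('a) ^ l" and "x ^ r = x"
  shows "poly (map_poly (\<lambda>c. c ^ r) f) x = poly f x ^ r"
proof -
  have "r > 0"
    using assms(1,2) by (simp add: prime_gt_0_nat)
  have "(x ^ i) ^ r = x ^ i" for i
    using assms(3) by (metis mult.commute power_mult)
  then have x_powers: "(c * x ^ i) ^ r = c ^ r * x ^ i" for c i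
    by (simp add: power_mult_distrib)
  have "poly f x ^ r = (\<Sum>i\<le>degree f. (coeff f i * x ^ i) ^ r)"
    unfolding poly_altdef by (rule freshmans_dream_sum'[OF assms(1,2)])
  also have "\<dots> = (\<Sum>i\<le>degree f. coeff f i ^ r * x ^ i)"
    by (simp add: x_powers)
  also have "\<dots> = poly (map_poly (\<lambda>c. c ^ r) f) x"
    using \<open>r > 0\<close> by (simp add: poly_altdef degree_map_poly coeff_map_poly)
  finally show ?thesis ..
qed

section \<open>Node polynomials and Lagrange weights\<close>

text \<open>Stated through coefficients, so that the zero polynomial belongs to it even for
  \<open>t = 0\<close>.\<close>

definition polys_below :: "nat \<Rightarrow> 'a::zero poly set" where
  "polys_below t = {f. \<forall>i\<ge>t. coeff f i = 0}"

definition node_poly :: "('n \<Rightarrow> 'a::comm_ring_1) \<Rightarrow> 'n set \<Rightarrow> 'a poly" where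
  "node_poly a S = (\<Prod>j\<in>S. [:- a j, 1:])"

definition weighted_eval :: "('n \<Rightarrow> 'a::comm_ring_1) \<Rightarrow> ('n \<Rightarrow> 'a) \<Rightarrow> 'a poly \<Rightarrow> 'a ^ 'n" where
  "weighted_eval v a f = (\<chi> i. v i * poly f (a i))"

text \<open>The barycentric weights, i.e. the reciprocals of the derivative of
  \<open>node_poly a UNIV\<close> at the nodes.\<close>

definition lagrange_weight :: "('n::finite \<Rightarrow> 'a::field) \<Rightarrow> 'n \<Rightarrow> 'a" where
  "lagrange_weight a i = inverse (\<Prod>j\<in>UNIV - {i}. a i - a j)"

lemma mem_polys_below_iff: "f \<in> polys_below t \<longleftrightarrow> f = 0 \<or> degree f < t"
  unfolding polys_below_def
  by (auto simp: coeff_eq_0) (metis leading_coeff_0_iff not_le)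

lemma mult_mem_polys_below_iff:
  fixes f g :: "'a::idom poly"
  assumes "g \<noteq> 0"
  shows "g * f \<in> polys_below (degree g + t) \<longleftrightarrow> f \<in> polys_below t"
  using assms by (cases "f = 0") (auto simp: mem_polys_below_iff degree_mult_eq)

lemma poly_node_poly [simp]: "poly (node_poly a S) x = (\<Prod>j\<in>S. x - a j)"
  by (simp add: node_poly_def poly_prod)

lemma node_poly_nonzero [simp]: "node_poly a S \<noteq> (0 :: 'a::idom poly)"
  by (cases "finite S") (auto simp: node_poly_def)

lemma degree_node_poly [simp]: "degree (node_poly a S :: 'a::idom poly) = card S"
  by (simp add: node_poly_def degree_prod_eq_sum_degree)

lemma lead_coeff_node_poly: "coeff (node_poly a S) (card S) = (1 :: 'a::idom)"
proof -
  have "lead_coeff (node_poly a S) = 1"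
    unfolding node_poly_def lead_coeff_prod by simp
  then show ?thesis by simp
qed

lemma node_poly_dvd:
  fixes f :: "'a::idom poly"
  assumes "finite S" and "inj a" and "\<And>i. i \<in> S \<Longrightarrow> poly f (a i) = 0"
  shows "node_poly a S dvd f"
  using assms(1,3)
proof (induction S)
  case empty
  then show ?case by (simp add: node_poly_def)
next
  case (insert i S)
  then obtain g where g: "f = node_poly a S * g"
    by (auto simp: dvd_def)
  \<comment> \<open>Distinct nodes: the product over \<open>S\<close> does not vanish at
    \<open>a i\<close>, so the zero there must come from the cofactor \<open>g\<close>.\<close>
  have "poly (node_poly a S) (a i) \<noteq> 0"
    using insert(1,2) assms(2) by (auto simp: inj_eq)
  moreover have "poly f (a i) = 0"
    using insert.prems by simp
  ultimately have "[:- a i, 1:] dvd g"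
    by (simp add: g poly_eq_0_iff_dvd[symmetric])
  then have "[:- a i, 1:] * node_poly a S dvd g * node_poly a S"
    by (rule mult_dvd_mono) simp
  moreover have "node_poly a (insert i S) = [:- a i, 1:] * node_poly a S"
    unfolding node_poly_def using insert(1,2) by (rule prod.insert)
  ultimately show ?case
    by (simp only: g mult.commute)
qed

lemma card_zeros_le_degree:
  fixes f :: "'a::idom poly" and a :: "'n::finite \<Rightarrow> 'a"
  assumes "inj a" and "f \<noteq> 0"
  shows "card {i. poly f (a i) = 0} \<le> degree f"
proof -
  have "card {i. poly f (a i) = 0} = card (a ` {i. poly f (a i) = 0})"
    using assms(1) by (simp add: card_image inj_on_subset)
  also have "\<dots> \<le> card {x. poly f x = 0}"
    using assms(2) by (intro card_mono poly_roots_finite) auto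
  also have "\<dots> \<le> degree f"
    by (rule card_poly_roots_bound[OF assms(2)])
  finally show ?thesis .
qed

text \<open>The left-hand side is the coefficient of \<open>X ^ (n - 1)\<close> in the polynomial of degree less
  than \<open>n\<close> that interpolates \<open>f\<close> at the \<open>n\<close> nodes, and that polynomial is \<open>f\<close>.\<close>
lemma lagrange_weight_annihilates:
  fixes a :: "'n::finite \<Rightarrow> 'a::field"
  assumes "inj a" and "degree f < CARD('n) - 1"
  shows "(\<Sum>i\<in>UNIV. lagrange_weight a i * poly f (a i)) = 0"
proof -
  define g where "g = (\<Sum>i\<in>UNIV. smult (lagrange_weight a i * poly f (a i)) (node_poly a (UNIV - {i})))"
  have card: "card (UNIV - {i}) = CARD('n) - 1" for i :: 'n
    by simp
  have eval: "poly g (a i) = poly f (a i)" for i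
  proof -
    have "poly g (a i) = (\<Sum>j\<in>UNIV. lagrange_weight a j * poly f (a j) * (\<Prod>m\<in>UNIV - {j}. a i - a m))"
      by (simp add: g_def poly_sum)
    also have "\<dots> = (\<Sum>j\<in>{i}. lagrange_weight a j * poly f (a j) * (\<Prod>m\<in>UNIV - {j}. a i - a m))"
      by (rule sum.mono_neutral_right) auto
    also have "\<dots> = poly f (a i)"
      using assms(1) by (simp add: lagrange_weight_def inj_eq)
    finally show ?thesis .
  qed
  have "degree g \<le> CARD('n) - 1"
    unfolding g_def by (intro degree_sum_le) (auto simp: card intro: order_trans[OF degree_smult_le])
  then have "g = f"
    using assms eval
    by (intro poly_eqI_degree[of "range a"]) (auto simp: card_image)
  then have "0 = coeff g (CARD('n) - 1)"
    using assms(2) by (simp add: coeff_eq_0)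
  \<comment> \<open>Each node polynomial on \<open>n - 1\<close> nodes is monic of degree
    \<open>n - 1\<close>, so only the scalar factors remain.\<close>
  also have "\<dots> = (\<Sum>i\<in>UNIV. lagrange_weight a i * poly f (a i))"
    using lead_coeff_node_poly[of a "UNIV - {i}" for i] by (simp add: g_def coeff_sum card)
  finally show ?thesis ..
qed

section \<open>Evaluation codes: dimension and minimum distance\<close>

lemma weighted_eval_diff: "weighted_eval v a (f - g) = weighted_eval v a f - weighted_eval v a g"
  by (simp add: weighted_eval_def vec_eq_iff algebra_simps)

lemma weighted_eval_add: "weighted_eval v a (f + g) = weighted_eval v a f + weighted_eval v a g"
  by (simp add: weighted_eval_def vec_eq_iff algebra_simps)

lemma weighted_eval_smult: "weighted_eval v a (smult c f) = c *s weighted_eval v a f"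
  by (simp add: weighted_eval_def vec_eq_iff algebra_simps)

lemma weighted_eval_0 [simp]: "weighted_eval v a 0 = 0"
  by (simp add: weighted_eval_def vec_eq_iff)

lemma weighted_eval_eq_0:
  fixes a :: "'n::finite \<Rightarrow> 'a::field"
  assumes "inj a" and "\<And>i. v i \<noteq> 0" and "f \<in> polys_below CARD('n)" and "weighted_eval v a f = 0"
  shows "f = 0"
proof (rule ccontr)
  assume "f \<noteq> 0"
  have "{i. poly f (a i) = 0} = UNIV"
    using assms(2,4) by (auto simp: weighted_eval_def vec_eq_iff)
  then show False
    using card_zeros_le_degree[OF assms(1) \<open>f \<noteq> 0\<close>] assms(3) \<open>f \<noteq> 0\<close>
    by (simp add: mem_polys_below_iff)
qed

text \<open>Used twice: \<open>g = 1\<close> gives the code itself, and a node polynomial gives its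
  hull. The degree bound keeps evaluation injective on the multiples of \<open>g\<close>, so the
  images of \<open>1, X, ..., X ^ (t - 1)\<close> form a basis.\<close>

lemma weighted_eval_multiples:
  fixes a :: "'n::finite \<Rightarrow> 'a::field"
  assumes "inj a" and "\<And>i. v i \<noteq> 0" and "g \<noteq> 0" and "degree g + t \<le> CARD('n)"
  shows "vec.subspace ((\<lambda>f. weighted_eval v a (g * f)) ` polys_below t)" (is ?subspace)
    and "vec.dim ((\<lambda>f. weighted_eval v a (g * f)) ` polys_below t) = t" (is ?dim)
proof -
  let ?E = "\<lambda>f. weighted_eval v a (g * f)"
  define b where "b m = ?E (monom 1 m)" for m
  have E_diff: "?E (f - c) = ?E f - ?E c" for f c
    by (simp add: weighted_eval_diff algebra_simps)
  have E_monom: "?E (monom c m) = c *s b m" for c m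
    unfolding b_def weighted_eval_smult[symmetric] by (simp add: smult_monom flip: mult_smult_right)
  have E_inj: "f = 0" if "?E f = 0" "f \<in> polys_below t" for f
  proof -
    have "g * f \<in> polys_below CARD('n)"
      using that(2) assms(3,4) by (cases "f = 0") (auto simp: mem_polys_below_iff degree_mult_eq)
    then have "g * f = 0"
      using weighted_eval_eq_0[OF assms(1,2) _ that(1)] by simp
    then show ?thesis
      using assms(3) by simp
  qed
  have span: "vec.span (b ` {..<m}) = ?E ` polys_below m" for m
  proof (induction m)
    case 0
    have "polys_below 0 = {0 :: 'a poly}"
      by (auto simp: mem_polys_below_iff)
    then show ?case by simp
  next
    case (Suc m)
    have "x \<in> ?E ` polys_below (Suc m) \<longleftrightarrow> (\<exists>c. x - c *s b m \<in> ?E ` polys_below m)" (is "?L \<longleftrightarrow> ?R") for x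
    proof
      assume ?L
      then obtain f where f: "f \<in> polys_below (Suc m)" "x = ?E f" by blast
      then have "f - monom (coeff f m) m \<in> polys_below m"
        by (auto simp: polys_below_def le_Suc_eq dest: le_neq_implies_less)
      then show ?R
        unfolding f(2) E_monom[symmetric] E_diff[symmetric] by blast
    next
      assume ?R
      then obtain c f where f: "f \<in> polys_below m" "x - c *s b m = ?E f" by blast
      then have "x = ?E (f + monom c m)"
        unfolding distrib_left weighted_eval_add E_monom by (simp add: algebra_simps)
      moreover have "f + monom c m \<in> polys_below (Suc m)"
        using f(1) by (auto simp: polys_below_def)
      ultimately show ?L by blast
    qed
    then show ?case
      by (simp add: set_eq_iff lessThan_Suc vec.span_insert Suc.IH del: image_iff)
  qed
  have dim: "vec.dim (b ` {..<m}) = m" if "m \<le> t" for m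
    using that
  proof (induction m)
    case 0
    then show ?case by simp
  next
    case (Suc m)
    \<comment> \<open>Otherwise \<open>monom 1 m - f\<close>, with \<open>f\<close> of degree below
      \<open>m\<close>, would be a nonzero polynomial killed by the injective evaluation.\<close>
    have "b m \<notin> vec.span (b ` {..<m})"
    proof
      assume "b m \<in> vec.span (b ` {..<m})"
      then obtain f where f: "f \<in> polys_below m" "?E (monom 1 m) = ?E f"
        unfolding span by (auto simp: b_def)
      have "monom 1 m - f \<in> polys_below t"
        using f(1) Suc.prems by (auto simp: polys_below_def)
      then have "monom 1 m - f = 0"
        using f(2) by (intro E_inj) (simp_all add: E_diff)
      then have "coeff f m = 1"
        by (metis coeff_monom eq_iff_diff_eq_0)
      then show False
        using f(1) by (simp add: polys_below_def)
    qed
    then show ?case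
      using Suc by (simp add: lessThan_Suc vec.dim_insert)
  qed
  show ?subspace
    unfolding span[symmetric] by (rule vec.subspace_span)
  show ?dim
    unfolding span[symmetric] using dim[of t] by simp
qed

lemma hamming_distance_conv_diff:
  fixes x y :: "'a::group_add ^ 'n::finite"
  shows "hamming_distance x y = CARD('n) - card {i. (x - y) $ i = 0}"
proof -
  have "{i. x $ i \<noteq> y $ i} = UNIV - {i. (x - y) $ i = 0}"
    by auto
  then show ?thesis
    unfolding hamming_distance_def by (simp only: card_Diff_subset finite subset_UNIV)
qed

text \<open>A nonzero polynomial of degree below \<open>k\<close> vanishes at no more than
  \<open>k - 1\<close> nodes; the node polynomial of \<open>k - 1\<close> nodes attains this
  bound.\<close>

lemma reed_solomon_mds:
  fixes a :: "'n::finite \<Rightarrow> 'a::{field,finite}"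
  assumes "inj a" and "\<And>i. v i \<noteq> 0" and "1 \<le> k" and "k \<le> CARD('n)"
  shows "mds_code CARD('n) k (weighted_eval v a ` polys_below k)"
proof -
  let ?n = "CARD('n)" and ?C = "weighted_eval v a ` polys_below k"
  have linear: "linear_code ?n k ?C"
    using weighted_eval_multiples[of a v 1 k] assms by (simp add: linear_code_def)
  let ?D = "{hamming_distance x y | x y. x \<in> ?C \<and> y \<in> ?C \<and> x \<noteq> y}"
  have zeros: "{i. weighted_eval v a f $ i = 0} = {i. poly f (a i) = 0}" for f
    using assms(2) by (simp add: weighted_eval_def)
  have lower: "?n - k + 1 \<le> d" if d: "d \<in> ?D" for d
  proof -
    obtain f g where fg: "f \<in> polys_below k" "g \<in> polys_below k" "weighted_eval v a f \<noteq> weighted_eval v a g"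
      and d_eq: "d = hamming_distance (weighted_eval v a f) (weighted_eval v a g)"
      using d by auto
    have "f - g \<noteq> 0" "f - g \<in> polys_below k"
      using fg by (auto simp: polys_below_def)
    then have "card {i. poly (f - g) (a i) = 0} < k"
      using card_zeros_le_degree[OF assms(1), of "f - g"] by (simp add: mem_polys_below_iff)
    then show ?thesis
      using assms(4)
      unfolding d_eq hamming_distance_conv_diff weighted_eval_diff[symmetric] zeros by linarith
  qed
  obtain S :: "'n set" where S: "card S = k - 1"
    using assms(4) by (metis obtain_subset_with_card_n diff_le_self order_trans)
  have S_zeros: "{i. poly (node_poly a S) (a i) = 0} = S"
    using assms(1) by (auto simp: inj_eq)
  let ?x = "weighted_eval v a (node_poly a S)"
  have dist: "hamming_distance ?x 0 = ?n - k + 1"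
    unfolding hamming_distance_conv_diff diff_zero zeros S_zeros S using assms(3,4) by simp
  have "?x \<in> ?C" "0 \<in> ?C"
    using S assms(3) linear
    by (auto simp: linear_code_def mem_polys_below_iff vec.subspace_0)
  moreover have "?x \<noteq> 0"
    using dist by (auto simp: hamming_distance_def)
  ultimately have "?n - k + 1 \<in> ?D"
    using dist by (metis (mono_tags, lifting) mem_Collect_eq)
  then have "min_distance ?C = ?n - k + 1"
    unfolding min_distance_def using lower by (intro cInf_eq_minimum)
  with linear show ?thesis
    by (simp add: mds_code_def)
qed

section \<open>The Galois hull of the code\<close>

text \<open>With all weights equal to \<open>u = lagrange_weight a\<close> the form vanishes identically on the code,
  because products of two polynomials of degree below \<open>k\<close> have degree at most \<open>n - 2\<close>. Changing
  the sign of \<open>u i\<close> for \<open>i \<in> S\<close> leaves the form \<open>- 2 * (\<Sum>i\<in>S. u i * g (a i) * f (a i) ^ r)\<close>, which is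
  nondegenerate on the values at \<open>S\<close>.\<close>
lemma reed_solomon_hull:
  fixes a :: "'n::finite \<Rightarrow> 'a::field"
  assumes char: "prime CHAR('a)" "CHAR('a) = p" "(2 :: 'a) \<noteq> 0"
    and a: "inj a" "\<And>i. a i ^ p ^ l = a i"
    and v: "\<And>i. v i ^ (p ^ l + 1) = (if i \<in> S then - lagrange_weight a i else lagrange_weight a i)"
    and k: "1 \<le> k" "2 * k \<le> CARD('n)" "card S \<le> k"
  shows "galois_hull p l (weighted_eval v a ` polys_below k)
       = (\<lambda>f. weighted_eval v a (node_poly a S * f)) ` polys_below (k - card S)"
proof -
  define r where "r = p ^ l"
  have "r > 0"
    using char by (simp add: r_def prime_gt_0_nat)
  define \<sigma> where "\<sigma> = map_poly (\<lambda>c :: 'a. c ^ r)"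
  have form: "galois_form p l (weighted_eval v a g) (weighted_eval v a f)
      = - 2 * (\<Sum>i\<in>S. lagrange_weight a i * (poly g (a i) * poly f (a i) ^ r))" (is "_ = - 2 * ?s")
    if "f \<in> polys_below k" "g \<in> polys_below k" for f g
  proof -
    let ?t = "\<lambda>i. lagrange_weight a i * (poly g (a i) * poly f (a i) ^ r)"
    have "degree (\<sigma> f) = degree f"
      unfolding \<sigma>_def using \<open>r > 0\<close> by (simp add: degree_map_poly)
    moreover have "degree f < k" "degree g < k"
      using that k(1) by (auto simp: mem_polys_below_iff)
    ultimately have "degree (g * \<sigma> f) < CARD('n) - 1"
      using degree_mult_le[of g "\<sigma> f"] k by linarith
    then have "(\<Sum>i\<in>UNIV. lagrange_weight a i * poly (g * \<sigma> f) (a i)) = 0"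
      by (rule lagrange_weight_annihilates[OF a(1)])
    moreover have "poly (\<sigma> f) (a i) = poly f (a i) ^ r" for i
      unfolding \<sigma>_def using char a(2) by (intro poly_frobenius) (auto simp: r_def)
    ultimately have zero: "(\<Sum>i\<in>UNIV. ?t i) = 0"
      by simp
    have "galois_form p l (weighted_eval v a g) (weighted_eval v a f)
        = (\<Sum>i\<in>UNIV. v i ^ (p ^ l + 1) * (poly g (a i) * poly f (a i) ^ r))"
      by (simp add: galois_form_def weighted_eval_def r_def power_mult_distrib algebra_simps)
    also have "\<dots> = (\<Sum>i\<in>UNIV. ?t i - (if i \<in> S then 2 * ?t i else 0))"
      unfolding v by (intro sum.cong) auto
    also have "\<dots> = - (\<Sum>i\<in>UNIV. if i \<in> S then 2 * ?t i else 0)"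
      by (simp only: sum_subtractf zero) simp
    also have "\<dots> = - 2 * ?s"
      by (simp add: sum.If_cases sum_distrib_left sum_negf)
    finally show ?thesis .
  qed
  have hull_iff: "weighted_eval v a f \<in> galois_dual p l (weighted_eval v a ` polys_below k)
      \<longleftrightarrow> (\<forall>i\<in>S. poly f (a i) = 0)" (is "?L \<longleftrightarrow> ?R") if f: "f \<in> polys_below k" for f
  proof
    assume ?R
    then show ?L
      using \<open>r > 0\<close> by (auto simp: galois_dual_def form[OF f] power_0_left)
  next
    assume ?L
    show ?R
    proof
      fix i assume "i \<in> S"
      \<comment> \<open>A test codeword that vanishes at every place of \<open>S\<close> except
        \<open>i\<close>, so it isolates the \<open>i\<close>-th term of the form.\<close>
      let ?g = "node_poly a (S - {i})"
      have "card (S - {i}) < k"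
        using \<open>i \<in> S\<close> k(3) by (metis card_Diff1_less finite less_le_trans)
      then have g: "?g \<in> polys_below k"
        by (simp add: mem_polys_below_iff)
      then have "galois_form p l (weighted_eval v a ?g) (weighted_eval v a f) = 0"
        using \<open>?L\<close> by (auto simp: galois_dual_def)
      then have "0 = (\<Sum>j\<in>S. lagrange_weight a j * (poly ?g (a j) * poly f (a j) ^ r))"
        using char(3) form[OF f g] by simp
      also have "\<dots> = (\<Sum>j\<in>{i}. lagrange_weight a j * (poly ?g (a j) * poly f (a j) ^ r))"
        using \<open>i \<in> S\<close> by (intro sum.mono_neutral_right) auto
      finally show "poly f (a i) = 0"
        using a(1) by (auto simp: lagrange_weight_def inj_eq)
    qed
  qed
  \<comment> \<open>Vanishing on \<open>S\<close> means divisibility by the node polynomial of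
    \<open>S\<close>, which leaves a cofactor of degree below \<open>k - card S\<close>.\<close>
  have "{f \<in> polys_below k. \<forall>i\<in>S. poly f (a i) = 0} = (*) (node_poly a S) ` polys_below (k - card S)"
  proof (intro equalityI subsetI)
    fix f assume f: "f \<in> {f \<in> polys_below k. \<forall>i\<in>S. poly f (a i) = 0}"
    then obtain g where g: "f = node_poly a S * g"
      using node_poly_dvd[of S a f] a(1) by (auto simp: dvd_def)
    then show "f \<in> (*) (node_poly a S) ` polys_below (k - card S)"
      using f k(3) mult_mem_polys_below_iff[of "node_poly a S" g "k - card S"] by auto
  next
    fix f assume "f \<in> (*) (node_poly a S) ` polys_below (k - card S)"
    then show "f \<in> {f \<in> polys_below k. \<forall>i\<in>S. poly f (a i) = 0}"
      using k(3) mult_mem_polys_below_iff[of "node_poly a S" _ "k - card S"] by auto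
  qed
  then have "weighted_eval v a ` {f \<in> polys_below k. \<forall>i\<in>S. poly f (a i) = 0}
      = (\<lambda>f. weighted_eval v a (node_poly a S * f)) ` polys_below (k - card S)"
    by (simp add: image_image)
  moreover have "galois_hull p l (weighted_eval v a ` polys_below k)
      = weighted_eval v a ` {f \<in> polys_below k. \<forall>i\<in>S. poly f (a i) = 0}"
    using hull_iff by (auto simp: galois_hull_def)
  ultimately show ?thesis
    by simp
qed

section \<open>Choice of nodes, signs and multipliers\<close>

theorem theorem2:
  fixes p e l n k h :: nat
  assumes "prime p" and "odd p" and "e \<ge> 1"
    and "CARD('a::{field,finite}) = p ^ e"
    and "l \<le> e - 1" and "2 * l dvd e"
    and "CARD('n::finite) = n" and "n \<le> p ^ l"
    and "1 \<le> k" and "k \<le> n div 2" and "h \<le> k"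
  shows "\<exists>C :: ('a ^ 'n) set. mds_code n k C \<and> vec.dim (galois_hull p l C) = h"
proof -
  define r where "r = p ^ l"
  have kn: "2 * k \<le> CARD('n)"
    using assms(7,10) by linarith
  \<comment> \<open>From \<open>2 \<le> 2 * k \<le> n \<le> p ^ l\<close>; in particular
    \<open>l = 0\<close> cannot occur.\<close>
  then have "r > 1"
    using assms(7-9) by (simp add: r_def)
  obtain s where "e = 2 * l * s"
    using assms(6) by (auto simp: dvd_def)
  then have card: "CARD('a) = (r ^ 2) ^ s"
    using assms(4) by (simp add: r_def mult.commute mult.left_commute flip: power_mult)
  have char: "CHAR('a) = p"
    using assms(1,4) by (rule CHAR_eq_prime)
  then have prime_char: "prime CHAR('a)"
    using assms(1) by simp
  have two: "(2 :: 'a) \<noteq> 0"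
  proof
    assume "(2 :: 'a) = 0"
    then have "p dvd 2"
      using of_nat_eq_0_iff_char_dvd[of 2, where ?'a = 'a] char by simp
    then show False
      using assms(1,2) by (metis primes_dvd_imp_eq two_is_prime_nat)
  qed
  have "CARD('n) \<le> card {x :: 'a. x ^ r = x}"
    using card_subfield_ge[OF \<open>r > 1\<close> card] assms(7,8) by (simp add: r_def)
  then obtain a :: "'n \<Rightarrow> 'a" where a: "inj a" "range a \<subseteq> {x. x ^ r = x}"
    using card_le_inj[of "UNIV :: 'n set" "{x :: 'a. x ^ r = x}"] by auto
  then have a_fixed: "a i ^ r = a i" for i
    by auto
  have "(- 1 :: 'a) ^ r = - 1"
    using assms(2) by (simp add: r_def)
  \<comment> \<open>Apply additivity of the \<open>r\<close>-th power to \<open>(x - y) + y\<close>.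
    The weights are built from the nodes by field operations, so they are fixed too.\<close>
  moreover have "(x - y) ^ r = x ^ r - y ^ r" for x y :: 'a
    using freshmans_dream'[OF prime_char, of r l "x - y" y] by (simp add: r_def char)
  ultimately have weight_fixed: "lagrange_weight a i ^ r = lagrange_weight a i" for i
    by (simp add: lagrange_weight_def power_inverse prod_power_distrib a_fixed)
  have weight_nonzero: "lagrange_weight a i \<noteq> 0" for i
    using a(1) by (auto simp: lagrange_weight_def inj_eq)
  \<comment> \<open>With this size the hull has dimension \<open>k - card S = h\<close>.\<close>
  obtain S :: "'n set" where S: "card S = k - h"
    using kn by (metis obtain_subset_with_card_n diff_le_self le_add1 mult_2 order_trans)
  define w where "w i = (if i \<in> S then - lagrange_weight a i else lagrange_weight a i)" for i
  have w_nonzero: "w i \<noteq> 0" for i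
    using weight_nonzero by (simp add: w_def)
  \<comment> \<open>Since \<open>r\<close> is odd, the sign change stays within the fixed field,
    where every nonzero element is an \<open>(r + 1)\<close>-th power.\<close>
  have "w i ^ r = w i" for i
    using weight_fixed assms(2) by (simp add: w_def power_minus_odd r_def)
  then have "\<exists>v. v ^ (r + 1) = w i" for i
    using norm_surjective[OF \<open>r > 1\<close> card] w_nonzero by metis
  then obtain v where v: "\<And>i. v i ^ (r + 1) = w i"
    by metis
  have v_nonzero: "v i \<noteq> 0" for i
    using v[of i] w_nonzero[of i] by auto
  let ?C = "weighted_eval v a ` polys_below k"
  have "galois_hull p l ?C = (\<lambda>f. weighted_eval v a (node_poly a S * f)) ` polys_below (k - card S)"
    using v a a_fixed assms(9) kn S
    by (intro reed_solomon_hull[OF prime_char char two]) (auto simp: w_def r_def)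
  then have "vec.dim (galois_hull p l ?C) = h"
    using weighted_eval_multiples(2)[of a v "node_poly a S" "k - card S"] a(1) v_nonzero S kn assms(11)
    by simp
  moreover have "mds_code n k ?C"
    using reed_solomon_mds[of a v k] a(1) v_nonzero assms(7,9) kn by simp
  ultimately show ?thesis
    by blast
qed

end
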